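(* Let $\Omega\subset\mathbb{C}^n$ be a bounded domain satisfying Condition $C_6$, with Bergman statistical model $\Phi:\Omega\to\mathcal{P}(\Omega,dV)$, $\Phi(z)=P(z,\xi)\,dV(\xi)$, $P(z,\xi)=\frac{|\mathcal{B}(z,\xi)|^2}{\mathcal{B}(z,z)}$. Then $\Phi(\Omega)$ is never an exponential family in $\mathcal{P}(\Omega,dV)$.
   Context: $\mathcal{B}$ is the Bergman kernel of $\Omega$ (reproducing kernel of the $L^2$ holomorphic functions w.r.t. Lebesgue measure $dV$); $\mathcal{P}(\Omega,dV)$ is the set of probability measures with a.e. positive density w.r.t. $dV$. A statistical model $M\to\mathcal{P}(\Xi,\mu_0)$ with $\dim_{\mathbb{R}}M=N$ and density $P(x,\xi)$ is an exponential family if, in some coordinate system $(x_1,\dots,x_N)$ of $M$, there are functions $C,F_1,\dots,F_N$ on $\Xi$ and a function $\psi$ on $M$ with $P(x,\xi)=\exp\big[C(\xi)+\sum_{i=1}^Nx_iF_i(\xi)-\psi(x)\big]$. (Here $M=\Omega$, $N=2n$.) Condition $C_k$: with $l=\log P$ and derivatives taken in $z$, for all nonzero multi-indices $\Gamma_1,\dots,\Gamma_A,\Lambda_1,\dots,\Lambda_B\in\mathbb{N}_0^n$ with $\sum_i|\Gamma_i|+\sum_j|\Lambda_j|\le k$, the function $\prod_i(\partial^{\Gamma_i}l)\prod_j(\overline\partial^{\Lambda_j}l)$ of $\xi$ lies in $L^1(\Omega,\Phi(z))$ for each $z\in\Omega$, and its $L^1(\Omega,\Phi(z))$-norm is a continuous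 function of $z\in\Omega$. *)

theory Defs
  imports "HOL-Analysis.Analysis"
begin

section \<open>Bergman space and Bergman kernel\<close>

definition holomorphic_sv :: "(complex ^ 'n \<Rightarrow> complex) \<Rightarrow> (complex ^ 'n) set \<Rightarrow> bool" where
  "holomorphic_sv f S \<longleftrightarrow>
     (\<forall>z\<in>S. \<exists>D. (f has_derivative D) (at z) \<and> (\<forall>c v. D (c *s v) = c * D v))"

definition bergman_space :: "(complex ^ 'n) set \<Rightarrow> (complex ^ 'n \<Rightarrow> complex) set" where
  "bergman_space \<Omega> =
     {f. holomorphic_sv f \<Omega> \<and> integrable (lebesgue_on \<Omega>) (\<lambda>\<xi>. (cmod (f \<xi>))\<^sup>2)}"

text \<open>
  The reproducing kernel of the Bergman space, holomorphic in the first and antiholomorphic in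
  the second variable.  It is unique on \<open>\<Omega> \<times> \<Omega>\<close>; the values elsewhere are unconstrained
  and are not used below.
\<close>

definition is_bergman_kernel ::
  "(complex ^ 'n) set \<Rightarrow> (complex ^ 'n \<Rightarrow> complex ^ 'n \<Rightarrow> complex) \<Rightarrow> bool" where
  "is_bergman_kernel \<Omega> B \<longleftrightarrow>
     (\<forall>z\<in>\<Omega>. (\<lambda>\<xi>. cnj (B z \<xi>)) \<in> bergman_space \<Omega> \<and>
        (\<forall>f\<in>bergman_space \<Omega>. f z = (LINT \<xi>|lebesgue_on \<Omega>. f \<xi> * B z \<xi>)))"


section \<open>The Bergman statistical model\<close>

text \<open>\<open>B z z\<close> is real, so taking its real part loses nothing.\<close>

definition bergman_density ::
  "(complex ^ 'n \<Rightarrow> complex ^ 'n \<Rightarrow> complex) \<Rightarrow> complex ^ 'n \<Rightarrow> complex ^ 'n \<Rightarrow> real" where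
  "bergman_density B z \<xi> = (cmod (B z \<xi>))\<^sup>2 / Re (B z z)"

definition bergman_model ::
  "(complex ^ 'n) set \<Rightarrow> (complex ^ 'n \<Rightarrow> complex ^ 'n \<Rightarrow> complex) \<Rightarrow>
     complex ^ 'n \<Rightarrow> (complex ^ 'n) measure" where
  "bergman_model \<Omega> B z = density (lebesgue_on \<Omega>) (\<lambda>\<xi>. ennreal (bergman_density B z \<xi>))"


section \<open>Wirtinger derivatives and the integrability condition\<close>

definition wirtinger ::
  "'n \<Rightarrow> (complex ^ 'n \<Rightarrow> complex) \<Rightarrow> complex ^ 'n \<Rightarrow> complex" where
  "wirtinger j f z =
     (frechet_derivative f (at z) (axis j 1) - \<i> * frechet_derivative f (at z) (axis j \<i>)) / 2"

definition wirtinger_bar ::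
  "'n \<Rightarrow> (complex ^ 'n \<Rightarrow> complex) \<Rightarrow> complex ^ 'n \<Rightarrow> complex" where
  "wirtinger_bar j f z =
     (frechet_derivative f (at z) (axis j 1) + \<i> * frechet_derivative f (at z) (axis j \<i>)) / 2"

text \<open>
  Multi-indices are functions \<open>'n \<Rightarrow> nat\<close>.  An arbitrary enumeration of the index type fixes the
  order in which the partial derivatives are composed; for smooth functions the order is immaterial.
\<close>

definition index_list :: "'n::finite list" where
  "index_list = (SOME js. distinct js \<and> set js = UNIV)"

definition multi_deriv ::
  "('n::finite \<Rightarrow> nat) \<Rightarrow> (complex ^ 'n \<Rightarrow> complex) \<Rightarrow> complex ^ 'n \<Rightarrow> complex" where
  "multi_deriv \<Gamma> f = foldr (\<lambda>j. wirtinger j ^^ \<Gamma> j) index_list f"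

definition multi_deriv_bar ::
  "('n::finite \<Rightarrow> nat) \<Rightarrow> (complex ^ 'n \<Rightarrow> complex) \<Rightarrow> complex ^ 'n \<Rightarrow> complex" where
  "multi_deriv_bar \<Lambda> f = foldr (\<lambda>j. wirtinger_bar j ^^ \<Lambda> j) index_list f"

definition multi_order :: "('n::finite \<Rightarrow> nat) \<Rightarrow> nat" where
  "multi_order \<Gamma> = (\<Sum>j\<in>UNIV. \<Gamma> j)"

text \<open>
  The log-likelihood as a function of the parameter \<open>z\<close>, for a fixed sample point \<open>\<xi>\<close>.
  For each \<open>z\<close> the points \<open>\<xi>\<close> with \<open>B z \<xi> = 0\<close>, where the value is the convention
  \<open>ln 0 = 0\<close>, form a null set; near every other pair \<open>(z, \<xi>)\<close> the function is smooth in \<open>z\<close>.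
\<close>

definition log_likelihood ::
  "(complex ^ 'n \<Rightarrow> complex ^ 'n \<Rightarrow> complex) \<Rightarrow> complex ^ 'n \<Rightarrow> complex ^ 'n \<Rightarrow> complex" where
  "log_likelihood B \<xi> z = complex_of_real (ln (bergman_density B z \<xi>))"

definition score_product ::
  "(complex ^ 'n \<Rightarrow> complex ^ 'n \<Rightarrow> complex) \<Rightarrow> ('n::finite \<Rightarrow> nat) list \<Rightarrow> ('n \<Rightarrow> nat) list \<Rightarrow>
     complex ^ 'n \<Rightarrow> complex ^ 'n \<Rightarrow> complex" where
  "score_product B \<Gamma>s \<Lambda>s z \<xi> =
     (\<Prod>\<Gamma>\<leftarrow>\<Gamma>s. multi_deriv \<Gamma> (log_likelihood B \<xi>) z) *
     (\<Prod>\<Lambda>\<leftarrow>\<Lambda>s. multi_deriv_bar \<Lambda> (log_likelihood B \<xi>) z)"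

definition condition_C ::
  "nat \<Rightarrow> (complex ^ 'n::finite) set \<Rightarrow> (complex ^ 'n \<Rightarrow> complex ^ 'n \<Rightarrow> complex) \<Rightarrow> bool" where
  "condition_C k \<Omega> B \<longleftrightarrow>
     (\<forall>\<Gamma>s \<Lambda>s.
        (\<forall>\<Gamma>\<in>set \<Gamma>s \<union> set \<Lambda>s. \<Gamma> \<noteq> (\<lambda>_. 0)) \<and>
        (\<Sum>\<Gamma>\<leftarrow>\<Gamma>s. multi_order \<Gamma>) + (\<Sum>\<Lambda>\<leftarrow>\<Lambda>s. multi_order \<Lambda>) \<le> k \<longrightarrow>
        (\<forall>z\<in>\<Omega>. integrable (bergman_model \<Omega> B z) (score_product B \<Gamma>s \<Lambda>s z)) \<and>
        continuous_on \<Omega> (\<lambda>z. LINT \<xi>|bergman_model \<Omega> B z. cmod (score_product B \<Gamma>s \<Lambda>s z \<xi>)))"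


section \<open>Exponential families\<close>

primrec Ck_on :: "nat \<Rightarrow> ('a::euclidean_space \<Rightarrow> 'b::euclidean_space) \<Rightarrow> 'a set \<Rightarrow> bool" where
  "Ck_on 0 f S \<longleftrightarrow> continuous_on S f"
| "Ck_on (Suc k) f S \<longleftrightarrow>
     (\<forall>x\<in>S. f differentiable (at x)) \<and> (\<forall>v. Ck_on k (\<lambda>x. frechet_derivative f (at x) v) S)"

definition smooth_on :: "('a::euclidean_space \<Rightarrow> 'b::euclidean_space) \<Rightarrow> 'a set \<Rightarrow> bool" where
  "smooth_on f S \<longleftrightarrow> (\<forall>k. Ck_on k f S)"

text \<open>
  A (global) coordinate system on an open subset \<open>M\<close> of an \<open>N\<close>-dimensional Euclidean space is a
  diffeomorphism of \<open>M\<close> onto an open subset of \<open>\<real>\<^sup>N\<close>.  The coordinate space is taken to be a copy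
  of the ambient space itself, and the \<open>N\<close> coordinates of \<open>x z\<close> are \<open>x z \<bullet> b\<close> for \<open>b \<in> Basis\<close>;
  for \<open>complex ^ 'n\<close> there are \<open>2 * CARD('n)\<close> of them.
\<close>

definition coordinate_system :: "'a::euclidean_space set \<Rightarrow> ('a \<Rightarrow> 'a) \<Rightarrow> bool" where
  "coordinate_system M x \<longleftrightarrow>
     smooth_on x M \<and> inj_on x M \<and> open (x ` M) \<and> smooth_on (inv_into M x) (x ` M)"

text \<open>
  Densities are meant up to \<open>\<mu>\<close>-null sets, so the defining equation is one between measures.
  It forces each \<open>\<Phi> z\<close> to have a positive density with respect to \<open>\<mu>\<close>, so that for a family of
  probability measures membership in the space of probability measures with a.e. positive density
  need not be required separately.
\<close>

definition exponential_family ::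
  "'a::euclidean_space set \<Rightarrow> 'x measure \<Rightarrow> ('a \<Rightarrow> 'x measure) \<Rightarrow> bool" where
  "exponential_family M \<mu> \<Phi> \<longleftrightarrow>
     (\<exists>x C F \<psi>. coordinate_system M x \<and>
        (\<forall>z\<in>M.
           (\<lambda>\<xi>. exp (C \<xi> + (\<Sum>b\<in>Basis. (x z \<bullet> b) * F b \<xi>) - \<psi> z)) \<in> borel_measurable \<mu> \<and>
           \<Phi> z = density \<mu>
             (\<lambda>\<xi>. ennreal (exp (C \<xi> + (\<Sum>b\<in>Basis. (x z \<bullet> b) * F b \<xi>) - \<psi> z)))))"

end

theory Submission
  imports Defs
begin

text \<open>
  On a bounded domain the coordinate functions are bounded multipliers of the Bergman space, so
  \<open>(R\<^sup>2 - z\<^sub>k cnj w\<^sub>k) B z w\<close> is a positive semidefinite kernel; taking the Schur product with \<open>cnj B\<close>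
  so is \<open>(R\<^sup>2 - z\<^sub>k cnj w\<^sub>k) \<bar>B z w\<bar>\<^sup>2\<close>.  If the model is an exponential family, then on a line
  \<open>t \<mapsto> x p + t a\<close> in its coordinates \<open>ln \<bar>B z \<xi>\<bar>\<^sup>2\<close> is affine in \<open>t\<close> up to a term independent of \<open>\<xi>\<close>,
  and the symmetry of \<open>\<bar>B\<bar>\<close> forces \<open>\<bar>B (\<gamma> t) (\<gamma> s)\<bar>\<^sup>2 = \<alpha> t * \<alpha> s * exp (c * t * s)\<close> along the
  corresponding curve \<open>\<gamma>\<close>.  With \<open>\<phi> t\<close> the \<open>k\<close>-th component of \<open>\<gamma> t\<close>, the kernel
  \<open>(R\<^sup>2 - \<phi> t cnj (\<phi> s)) exp (c t s)\<close> is then positive semidefinite near \<open>0\<close>.  Testing it against the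
  \<open>m\<close>-th finite difference with step tending to \<open>0\<close> gives \<open>m \<bar>\<phi>' 0\<bar>\<^sup>2 \<le> c R\<^sup>2\<close> for all \<open>m\<close> if
  \<open>c > 0\<close>, and \<open>\<phi>' 0 = 0\<close> if \<open>c = 0\<close>.  But \<open>a\<close> can be chosen with \<open>\<phi>' 0 = 1\<close>.
\<close>

section \<open>Multipliers of exponential kernels on an interval\<close>

text \<open>Up to sign these sums are the \<open>m\<close>-th finite difference of
  \<open>i ^ k\<close> at 0, which annihilates degrees below \<open>m\<close>. For the induction,
  the absorption identity \<open>i * (Suc m choose i) = Suc m * (m choose (i - 1))\<close> uses up
  one factor \<open>i\<close> and lowers \<open>m\<close>; expanding \<open>(i + 1) ^ k\<close> then
  leaves moments for \<open>m\<close>.\<close>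

lemma alternating_binomial_moments:
  "(\<forall>k<m. (\<Sum>i\<le>m. (-1)^i * real (m choose i) * real i ^ k) = 0) \<and>
   (\<Sum>i\<le>m. (-1)^i * real (m choose i) * real i ^ m) = (-1)^m * fact m"
proof (induction m)
  case 0
  then show ?case by simp
next
  case (Suc m)
  have rec: "(\<Sum>i\<le>Suc m. (-1)^i * real (Suc m choose i) * real i ^ Suc k)
      = - real (Suc m) * (\<Sum>l\<le>k. real (k choose l) *
          (\<Sum>i\<le>m. (-1)^i * real (m choose i) * real i ^ l))" for k
  proof -
    have "(\<Sum>i\<le>Suc m. (-1)^i * real (Suc m choose i) * real i ^ Suc k)
        = (\<Sum>i\<le>m. (-1)^Suc i * real (Suc i * (Suc m choose Suc i)) * real (Suc i) ^ k)"
      by (subst sum.atMost_Suc_shift) (simp add: algebra_simps del: binomial_Suc_Suc)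
    also have "\<dots> = - real (Suc m) * (\<Sum>i\<le>m. (-1)^i * real (m choose i) * (real i + 1) ^ k)"
      by (simp only: Suc_times_binomial of_nat_mult of_nat_Suc sum_distrib_left)
        (simp add: algebra_simps)
    also have "(\<Sum>i\<le>m. (-1)^i * real (m choose i) * (real i + 1) ^ k)
       = (\<Sum>i\<le>m. \<Sum>l\<le>k. real (k choose l) * ((-1)^i * real (m choose i) * real i ^ l))"
      unfolding binomial_ring by (simp add: sum_distrib_left mult_ac)
    also have "\<dots> = (\<Sum>l\<le>k. real (k choose l) *
          (\<Sum>i\<le>m. (-1)^i * real (m choose i) * real i ^ l))"
      by (subst sum.swap) (simp add: sum_distrib_left)
    finally show ?thesis .
  qed
  have "(\<Sum>i\<le>Suc m. (-1)^i * real (Suc m choose i) * real i ^ k) = 0" if "k < Suc m" for k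
  proof (cases k)
    case 0
    then show ?thesis
      using choose_alternating_sum[of "Suc m", where 'a=real] by simp
  next
    case (Suc k')
    then have "(\<Sum>l\<le>k'. real (k' choose l) *
          (\<Sum>i\<le>m. (-1)^i * real (m choose i) * real i ^ l)) = 0"
      using that Suc.IH by (intro sum.neutral) auto
    then show ?thesis unfolding \<open>k = Suc k'\<close> rec by simp
  qed
  moreover have "(\<Sum>i\<le>Suc m. (-1)^i * real (Suc m choose i) * real i ^ Suc m) = (-1)^Suc m * fact (Suc m)"
  proof -
    \<comment> \<open>By the induction hypothesis every moment below the \<open>m\<close>-th
      vanishes, so only \<open>l = m\<close> contributes.\<close>
    have "(\<Sum>l\<le>m. real (m choose l) * (\<Sum>i\<le>m. (-1)^i * real (m choose i) * real i ^ l))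
        = (\<Sum>l\<in>{m}. real (m choose l) * (\<Sum>i\<le>m. (-1)^i * real (m choose i) * real i ^ l))"
      using Suc.IH by (intro sum.mono_neutral_right) auto
    then show ?thesis unfolding rec using Suc.IH by (simp add: algebra_simps)
  qed
  ultimately show ?case by blast
qed

text \<open>Expanding the exponential turns the part with
  \<open>Re (\<phi> i * cnj (\<phi> j))\<close> into a series of nonnegative terms, each
  \<open>c ^ k / fact k\<close> times a squared modulus. A single term is at most the whole series,
  and \<open>psd\<close> bounds the series by the right-hand side.\<close>

lemma exp_kernel_coefficient_le:
  fixes \<phi> :: "'i \<Rightarrow> complex" and a t :: "'i \<Rightarrow> real"
  assumes "finite I" and "c \<ge> 0"
    and psd: "(\<Sum>i\<in>I. \<Sum>j\<in>I. a i * a j * (R - Re (\<phi> i * cnj (\<phi> j))) * exp (c * t i * t j)) \<ge> 0"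
  shows "c ^ k / fact k * (cmod (\<Sum>i\<in>I. complex_of_real (a i * t i ^ k) * \<phi> i))\<^sup>2
    \<le> R * (\<Sum>i\<in>I. \<Sum>j\<in>I. a i * a j * exp (c * t i * t j))"
proof -
  define S where "S k = (cmod (\<Sum>i\<in>I. complex_of_real (a i * t i ^ k) * \<phi> i))\<^sup>2" for k
  have S: "S k = (\<Sum>i\<in>I. \<Sum>j\<in>I. a i * a j * Re (\<phi> i * cnj (\<phi> j)) * (t i * t j) ^ k)" for k
  proof -
    have "complex_of_real (S k) = (\<Sum>i\<in>I. \<Sum>j\<in>I. complex_of_real (a i * t i ^ k) * \<phi> i *
        (complex_of_real (a j * t j ^ k) * cnj (\<phi> j)))"
      unfolding S_def complex_norm_square by (simp add: sum_product)
    also have "\<dots> = (\<Sum>i\<in>I. \<Sum>j\<in>I. complex_of_real (a i * a j * (t i * t j) ^ k) * (\<phi> i * cnj (\<phi> j)))"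
      by (intro sum.cong refl) (simp add: power_mult_distrib)
    finally have "Re (complex_of_real (S k)) = Re \<dots>" by simp
    then show ?thesis by (simp add: Re_sum algebra_simps)
  qed
  have "(\<lambda>k. \<Sum>i\<in>I. \<Sum>j\<in>I. a i * a j * Re (\<phi> i * cnj (\<phi> j)) * ((c * t i * t j) ^ k /\<^sub>R fact k))
      sums (\<Sum>i\<in>I. \<Sum>j\<in>I. a i * a j * Re (\<phi> i * cnj (\<phi> j)) * exp (c * t i * t j))"
    by (intro sums_sum sums_mult exp_converges)
  also have "(\<lambda>k. \<Sum>i\<in>I. \<Sum>j\<in>I. a i * a j * Re (\<phi> i * cnj (\<phi> j)) * ((c * t i * t j) ^ k /\<^sub>R fact k))
      = (\<lambda>k. c ^ k / fact k * S k)"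
    unfolding S by (rule ext) (simp add: sum_distrib_left power_mult_distrib field_simps)
  finally have sums: "(\<lambda>k. c ^ k / fact k * S k) sums
     (\<Sum>i\<in>I. \<Sum>j\<in>I. a i * a j * Re (\<phi> i * cnj (\<phi> j)) * exp (c * t i * t j))" .
  have "S k \<ge> 0" for k by (simp add: S_def)
  then have "c ^ k / fact k * S k \<le> (\<Sum>i\<in>I. \<Sum>j\<in>I. a i * a j * Re (\<phi> i * cnj (\<phi> j)) * exp (c * t i * t j))"
    using sum_le_suminf[of "\<lambda>k. c ^ k / fact k * S k" "{k}"] sums \<open>c \<ge> 0\<close>
    by (auto simp: sums_iff)
  also have "\<dots> \<le> R * (\<Sum>i\<in>I. \<Sum>j\<in>I. a i * a j * exp (c * t i * t j))"
    using psd by (simp add: algebra_simps sum_subtractf sum_distrib_left)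
  finally show ?thesis by (simp add: S_def)
qed

text \<open>By the binomial theorem the sum over \<open>j\<close> is
  \<open>(1 - exp (c * i * h\<^sup>2)) ^ m\<close> up to the weights. Spread over its
  \<open>m\<close> factors, the divisor \<open>h ^ m * h ^ m\<close> leaves difference quotients
  tending to \<open>- c * i\<close>, and the sum over \<open>i\<close> becomes the
  \<open>m\<close>-th moment, whose sign cancels that of \<open>(-c) ^ m\<close>.\<close>

lemma exp_kernel_finite_difference_tendsto:
  fixes c :: real
  shows "((\<lambda>h. \<Sum>i\<le>m. \<Sum>j\<le>m. ((-1)^i * real (m choose i) / h ^ m) * ((-1)^j * real (m choose j) / h ^ m) *
      exp (c * (real i * h) * (real j * h))) \<longlongrightarrow> fact m * c ^ m) (at 0)"
proof -
  define w where "w i = (-1)^i * real (m choose i)" for i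
  have inner: "(\<Sum>j\<le>m. w j * exp (y * real j)) = (1 - exp y) ^ m" for y
    using binomial_ring[of "- exp y" 1 m]
    by (simp add: w_def mult_ac exp_of_nat2_mult power_minus[of "exp y"])
  have eq: "(\<Sum>i\<le>m. \<Sum>j\<le>m. (w i / h ^ m) * (w j / h ^ m) * exp (c * (real i * h) * (real j * h)))
     = (\<Sum>i\<le>m. w i * ((1 - exp (c * real i * h\<^sup>2)) / h\<^sup>2) ^ m)" for h
  proof (intro sum.cong refl)
    fix i
    have "(\<Sum>j\<le>m. (w i / h ^ m) * (w j / h ^ m) * exp (c * (real i * h) * (real j * h)))
       = w i / (h\<^sup>2) ^ m * (\<Sum>j\<le>m. w j * exp (c * real i * h\<^sup>2 * real j))"
      by (simp add: sum_distrib_left power2_eq_square power_mult_distrib mult_ac)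
    then show "(\<Sum>j\<le>m. (w i / h ^ m) * (w j / h ^ m) * exp (c * (real i * h) * (real j * h)))
       = w i * ((1 - exp (c * real i * h\<^sup>2)) / h\<^sup>2) ^ m"
      unfolding inner by (simp add: power_divide)
  qed
  have lim: "((\<lambda>h. (1 - exp (b * h\<^sup>2)) / h\<^sup>2) \<longlongrightarrow> - b) (at 0)" for b :: real
  proof -
    have "((\<lambda>u. exp (b * u)) has_real_derivative b) (at 0)"
      by (auto intro!: derivative_eq_intros)
    then have "((\<lambda>u. (exp (b * u) - 1) / u) \<longlongrightarrow> b) (at 0)"
      by (simp add: has_field_derivative_iff)
    \<comment> \<open>The square of a nonzero real is nonzero, so \<open>u = h\<^sup>2\<close> may
      be substituted in the difference quotient at 0.\<close>
    moreover have "filterlim (\<lambda>h::real. h\<^sup>2) (at 0) (at 0)"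
      by (intro filterlim_atI tendsto_eq_intros) (auto simp: eventually_at intro: exI[of _ 1])
    ultimately have "((\<lambda>h. (exp (b * h\<^sup>2) - 1) / h\<^sup>2) \<longlongrightarrow> b) (at 0)"
      by (rule filterlim_compose)
    then have "((\<lambda>h. - ((exp (b * h\<^sup>2) - 1) / h\<^sup>2)) \<longlongrightarrow> - b) (at 0)"
      by (rule tendsto_minus)
    then show ?thesis by (simp add: minus_divide_left)
  qed
  have "((\<lambda>h. \<Sum>i\<le>m. w i * ((1 - exp (c * real i * h\<^sup>2)) / h\<^sup>2) ^ m) \<longlongrightarrow>
      (\<Sum>i\<le>m. w i * (- (c * real i)) ^ m)) (at 0)"
    by (intro tendsto_intros lim)
  also have "(\<Sum>i\<le>m. w i * (- (c * real i)) ^ m) = (-c) ^ m * (\<Sum>i\<le>m. w i * real i ^ m)"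
    by (simp add: sum_distrib_left mult_ac power_mult_distrib power_minus[of "c * _"] power_minus[of c])
  also have "\<dots> = fact m * c ^ m"
    using alternating_binomial_moments[of m]
    by (simp add: w_def power_mult_distrib[symmetric])
  finally show ?thesis unfolding eq[symmetric] by (simp add: w_def)
qed

lemma has_vector_derivative_quotient_tendsto:
  fixes f :: "real \<Rightarrow> 'a::real_normed_vector"
  assumes "(f has_vector_derivative d) (at 0)"
  shows "((\<lambda>h. (f h - f 0) /\<^sub>R h) \<longlongrightarrow> d) (at 0)"
proof -
  have "((\<lambda>h. norm (f h - f 0 - h *\<^sub>R d) / norm h) \<longlongrightarrow> 0) (at 0)"
    using assms by (simp add: has_vector_derivative_def has_derivative_at)
  then have "((\<lambda>h. norm ((f h - f 0) /\<^sub>R h - d)) \<longlongrightarrow> 0) (at 0)"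
  proof (rule Lim_transform_eventually)
    have "norm (f h - f 0 - h *\<^sub>R d) / norm h = norm ((f h - f 0) /\<^sub>R h - d)" if "h \<noteq> 0" for h
    proof -
      have "(f h - f 0) /\<^sub>R h - d = (f h - f 0 - h *\<^sub>R d) /\<^sub>R h"
        using that by (simp add: scaleR_diff_right)
      then show ?thesis by (simp add: divide_inverse)
    qed
    then show "\<forall>\<^sub>F h in at 0. norm (f h - f 0 - h *\<^sub>R d) / norm h = norm ((f h - f 0) /\<^sub>R h - d)"
      by (simp add: eventually_at_filter)
  qed
  then show ?thesis
    by (metis LIM_zero_cancel tendsto_norm_zero_cancel)
qed

text \<open>This is the difference of order \<open>Suc k\<close> of \<open>t ^ k * \<phi> t\<close>,
  a factor \<open>t\<close> short of the order. The \<open>k\<close>-th moment vanishes, so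
  \<open>\<phi>\<close> may be replaced by \<open>\<phi> - \<phi> 0\<close>; the missing factor then
  appears as a first-order difference quotient, and one derivative at 0 determines the
  limit.\<close>

lemma finite_difference_monomial_tendsto:
  fixes \<phi> :: "real \<Rightarrow> complex"
  assumes "(\<phi> has_vector_derivative d) (at 0)"
  shows "((\<lambda>h. \<Sum>i\<le>Suc k. complex_of_real ((-1)^i * real (Suc k choose i) / h ^ Suc k * (real i * h) ^ k) *
      \<phi> (real i * h)) \<longlongrightarrow> (-1) ^ Suc k * fact (Suc k) * d) (at 0)"
proof -
  define w where "w i = (-1)^i * real (Suc k choose i)" for i
  have mom: "(\<Sum>i\<le>Suc k. w i * real i ^ k) = 0"
      "(\<Sum>i\<le>Suc k. w i * real i ^ Suc k) = (-1) ^ Suc k * fact (Suc k)"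
    using alternating_binomial_moments[of "Suc k"] unfolding w_def by auto
  \<comment> \<open>The chain rule for \<open>h \<mapsto> i * h\<close> contributes the factor that
    raises \<open>i ^ k\<close> to \<open>i ^ Suc k\<close>.\<close>
  have lim: "((\<lambda>h. complex_of_real (real i ^ k) * ((\<phi> (real i * h) - \<phi> 0) /\<^sub>R h)) \<longlongrightarrow>
      complex_of_real (real i ^ Suc k) * d) (at 0)" for i :: nat
  proof -
    have "((\<lambda>h. real i * h) has_vector_derivative real i) (at 0)"
      using has_vector_derivative_mult_right[OF has_vector_derivative_id, of "real i"] by simp
    then have "((\<lambda>h. \<phi> (real i * h)) has_vector_derivative real i *\<^sub>R d) (at 0)"
      using vector_diff_chain_at[of "\<lambda>h. real i * h" "real i" 0 \<phi> d] assms
      by (simp add: o_def)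
    then have "((\<lambda>h. (\<phi> (real i * h) - \<phi> 0) /\<^sub>R h) \<longlongrightarrow> real i *\<^sub>R d) (at 0)"
      by (rule has_vector_derivative_quotient_tendsto[where f = "\<lambda>h. \<phi> (real i * h)", simplified])
    from tendsto_mult[OF tendsto_const this, of "complex_of_real (real i ^ k)"]
    show ?thesis by (simp add: scaleR_conv_of_real mult_ac)
  qed
  have "((\<lambda>h. \<Sum>i\<le>Suc k. complex_of_real (w i) *
      (complex_of_real (real i ^ k) * ((\<phi> (real i * h) - \<phi> 0) /\<^sub>R h))) \<longlongrightarrow>
      (\<Sum>i\<le>Suc k. complex_of_real (w i) * (complex_of_real (real i ^ Suc k) * d))) (at 0)"
    by (intro tendsto_sum tendsto_mult tendsto_const lim)
  also have "(\<Sum>i\<le>Suc k. complex_of_real (w i) * (complex_of_real (real i ^ Suc k) * d))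
     = complex_of_real (\<Sum>i\<le>Suc k. w i * real i ^ Suc k) * d"
    by (simp only: of_real_sum of_real_mult sum_distrib_right mult.assoc)
  also have "\<dots> = (-1) ^ Suc k * fact (Suc k) * d"
    unfolding mom by simp
  finally have L: "((\<lambda>h. \<Sum>i\<le>Suc k. complex_of_real (w i) *
      (complex_of_real (real i ^ k) * ((\<phi> (real i * h) - \<phi> 0) /\<^sub>R h))) \<longlongrightarrow>
      (-1) ^ Suc k * fact (Suc k) * d) (at 0)" .
  \<comment> \<open>The powers of \<open>h\<close> combine to \<open>1 / h\<close>, and the term
    with \<open>\<phi> 0\<close> carries the vanishing \<open>k\<close>-th moment.\<close>
  have eq: "(\<Sum>i\<le>Suc k. complex_of_real (w i) *
        (complex_of_real (real i ^ k) * ((\<phi> (real i * h) - \<phi> 0) /\<^sub>R h)))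
     = (\<Sum>i\<le>Suc k. complex_of_real (w i / h ^ Suc k * (real i * h) ^ k) * \<phi> (real i * h))"
    if "h \<noteq> 0" for h
  proof -
    have "(\<Sum>i\<le>Suc k. complex_of_real (w i) *
        (complex_of_real (real i ^ k) * ((\<phi> (real i * h) - \<phi> 0) /\<^sub>R h)))
      = (\<Sum>i\<le>Suc k. complex_of_real (w i * real i ^ k / h) * \<phi> (real i * h))
        - complex_of_real ((\<Sum>i\<le>Suc k. w i * real i ^ k)) * \<phi> 0 / h"
      by (simp only: of_real_sum sum_distrib_right sum_divide_distrib sum_subtractf[symmetric])
        (intro sum.cong refl, simp add: scaleR_conv_of_real divide_inverse algebra_simps)
    also have "\<dots> = (\<Sum>i\<le>Suc k. complex_of_real (w i * real i ^ k / h) * \<phi> (real i * h))"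
      unfolding mom by simp
    also have "\<dots> = (\<Sum>i\<le>Suc k. complex_of_real (w i / h ^ Suc k * (real i * h) ^ k) * \<phi> (real i * h))"
      using that by (intro sum.cong refl) (simp add: power_mult_distrib)
    finally show ?thesis .
  qed
  show ?thesis
    using L unfolding w_def[symmetric]
    by (rule Lim_transform_eventually)
      (unfold eventually_at_filter, intro always_eventually allI impI eq)
qed

text \<open>The coefficient bound of index \<open>k\<close> is tested on the difference of order
  \<open>Suc k\<close> with step \<open>h\<close>. As \<open>h\<close> tends to 0 both sides
  converge and yield \<open>bound\<close>, where for \<open>c > 0\<close> the factor
  \<open>Suc k\<close> on the left outgrows every constant.\<close>

lemma exp_kernel_multiplier_derivative_zero:
  fixes \<phi> :: "real \<Rightarrow> complex" and c R \<epsilon> :: real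
  assumes "\<epsilon> > 0" and c: "c \<ge> 0"
    and deriv: "(\<phi> has_vector_derivative d) (at 0)"
    and psd: "\<And>(I::nat set) a t. finite I \<Longrightarrow> (\<And>i. i \<in> I \<Longrightarrow> \<bar>t i\<bar> < \<epsilon>) \<Longrightarrow>
      (\<Sum>i\<in>I. \<Sum>j\<in>I. a i * a j * (R - Re (\<phi> (t i) * cnj (\<phi> (t j)))) * exp (c * t i * t j)) \<ge> 0"
  shows "d = 0"
proof -
  have bound: "real (Suc k) * c ^ k * (cmod d)\<^sup>2 \<le> R * c ^ Suc k" for k
  proof -
    let ?a = "\<lambda>h i. (-1)^i * real (Suc k choose i) / h ^ Suc k"
    have lhs: "((\<lambda>h. c ^ k / fact k * (cmod (\<Sum>i\<le>Suc k. complex_of_real (?a h i * (real i * h) ^ k) *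
      \<phi> (real i * h)))\<^sup>2) \<longlongrightarrow> c ^ k / fact k * (cmod ((-1) ^ Suc k * fact (Suc k) * d))\<^sup>2) (at 0)"
      by (intro tendsto_intros finite_difference_monomial_tendsto deriv)
    have rhs: "((\<lambda>h. R * (\<Sum>i\<le>Suc k. \<Sum>j\<le>Suc k. ?a h i * ?a h j * exp (c * (real i * h) * (real j * h))))
        \<longlongrightarrow> R * (fact (Suc k) * c ^ Suc k)) (at 0)"
      by (intro tendsto_mult tendsto_const exp_kernel_finite_difference_tendsto)
    have "eventually (\<lambda>h. c ^ k / fact k * (cmod (\<Sum>i\<le>Suc k. complex_of_real (?a h i * (real i * h) ^ k) *
      \<phi> (real i * h)))\<^sup>2 \<le> R * (\<Sum>i\<le>Suc k. \<Sum>j\<le>Suc k. ?a h i * ?a h j * exp (c * (real i * h) * (real j * h)))) (at 0)"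
      unfolding eventually_at
    \<comment> \<open>This radius keeps all nodes \<open>i * h\<close> with
      \<open>i \<le> Suc k\<close> inside the interval where \<open>psd\<close> applies.\<close>
    proof (intro exI[of _ "\<epsilon> / real (Suc k)"] conjI ballI impI)
      fix h :: real
      assume h: "h \<noteq> 0 \<and> dist h 0 < \<epsilon> / real (Suc k)"
      have "\<bar>real i * h\<bar> < \<epsilon>" if "i \<in> {..Suc k}" for i
      proof -
        have "\<bar>real i * h\<bar> \<le> real (Suc k) * \<bar>h\<bar>"
          using that by (auto simp: abs_mult intro!: mult_right_mono)
        also have "\<dots> < \<epsilon>"
          using h by (simp add: field_simps)
        finally show ?thesis .
      qed
      then show "c ^ k / fact k * (cmod (\<Sum>i\<le>Suc k. complex_of_real (?a h i * (real i * h) ^ k) *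
        \<phi> (real i * h)))\<^sup>2 \<le> R * (\<Sum>i\<le>Suc k. \<Sum>j\<le>Suc k. ?a h i * ?a h j * exp (c * (real i * h) * (real j * h)))"
        by (intro exp_kernel_coefficient_le c psd) auto
    qed (use \<open>\<epsilon> > 0\<close> in auto)
    then have "c ^ k / fact k * (cmod ((-1) ^ Suc k * fact (Suc k) * d))\<^sup>2 \<le> R * (fact (Suc k) * c ^ Suc k)"
      by (rule tendsto_le[OF at_neq_bot rhs lhs])
    also have "(cmod ((-1) ^ Suc k * fact (Suc k) * d))\<^sup>2 = (real (Suc k) * fact k)\<^sup>2 * (cmod d)\<^sup>2"
      by (simp add: norm_mult norm_power power_mult_distrib del: of_nat_Suc)
    finally have "(real (Suc k) * fact k) * (real (Suc k) * c ^ k * (cmod d)\<^sup>2)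
        \<le> (real (Suc k) * fact k) * (R * c ^ Suc k)"
      by (simp add: power2_eq_square mult_ac)
    then show ?thesis
      by (subst (asm) mult_le_cancel_left_pos) auto
  qed
  show ?thesis
  proof (cases "c = 0")
    case True
    \<comment> \<open>For \<open>k = 0\<close> the left side has \<open>c ^ 0 = 1\<close> while the
      right side has the factor \<open>c = 0\<close>.\<close>
    with bound[of 0] show ?thesis by simp
  next
    case False
    then have "real (Suc k) * (cmod d)\<^sup>2 \<le> R * c" for k
      using bound[of k] c mult_le_cancel_left_pos[of "c ^ k" "real (Suc k) * (cmod d)\<^sup>2" "R * c"]
      by (simp add: mult_ac)
    \<comment> \<open>Otherwise the multiples of \<open>(cmod d)\<^sup>2\<close> would be unbounded,
      by the Archimedean property.\<close>
    then have "\<not> 0 < (cmod d)\<^sup>2"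
      by (metis ex_less_of_nat_mult less_Suc_eq linorder_not_less of_nat_less_iff mult_less_cancel_right_pos order_less_trans)
    then show ?thesis by simp
  qed
qed

section \<open>Positivity of the Bergman kernel\<close>

lemma holomorphic_sv_continuous_on:
  "holomorphic_sv f S \<Longrightarrow> continuous_on S f"
  unfolding holomorphic_sv_def continuous_on_eq_continuous_within
  by (meson continuous_at_imp_continuous_at_within has_derivative_continuous)

lemma holomorphic_sv_const: "holomorphic_sv (\<lambda>_. c) S"
  unfolding holomorphic_sv_def by (intro ballI exI[of _ "\<lambda>_. 0"]) auto

lemma holomorphic_sv_nth: "holomorphic_sv (\<lambda>z. z $ k) S"
  unfolding holomorphic_sv_def
  by (intro ballI exI[of _ "\<lambda>z. z $ k"])
    (auto intro!: bounded_linear_imp_has_derivative bounded_linear_vec_nth)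

lemma holomorphic_sv_add:
  assumes "holomorphic_sv f S" "holomorphic_sv g S"
  shows "holomorphic_sv (\<lambda>z. f z + g z) S"
  unfolding holomorphic_sv_def
proof
  fix z assume "z \<in> S"
  then obtain D E where "(f has_derivative D) (at z)" "\<forall>c v. D (c *s v) = c * D v"
    "(g has_derivative E) (at z)" "\<forall>c v. E (c *s v) = c * E v"
    using assms unfolding holomorphic_sv_def by metis
  then show "\<exists>D. ((\<lambda>z. f z + g z) has_derivative D) (at z) \<and> (\<forall>c v. D (c *s v) = c * D v)"
    by (intro exI[of _ "\<lambda>v. D v + E v"]) (auto intro!: derivative_intros simp: distrib_left)
qed

lemma holomorphic_sv_mult:
  assumes "holomorphic_sv f S" "holomorphic_sv g S"
  shows "holomorphic_sv (\<lambda>z. f z * g z) S"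
  unfolding holomorphic_sv_def
proof
  fix z assume "z \<in> S"
  then obtain D E where "(f has_derivative D) (at z)" "\<forall>c v. D (c *s v) = c * D v"
    "(g has_derivative E) (at z)" "\<forall>c v. E (c *s v) = c * E v"
    using assms unfolding holomorphic_sv_def by metis
  then show "\<exists>D. ((\<lambda>z. f z * g z) has_derivative D) (at z) \<and> (\<forall>c v. D (c *s v) = c * D v)"
    by (intro exI[of _ "\<lambda>v. f z * E v + D v * g z"] conjI has_derivative_mult) (auto simp: algebra_simps)
qed

lemma holomorphic_sv_borel_measurable:
  assumes "holomorphic_sv f \<Omega>" "open \<Omega>"
  shows "f \<in> borel_measurable (lebesgue_on \<Omega>)"
  using assms by (intro continuous_imp_measurable_on_sets_lebesgue holomorphic_sv_continuous_on) auto

lemma bergman_space_borel_measurable: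
  "f \<in> bergman_space \<Omega> \<Longrightarrow> open \<Omega> \<Longrightarrow> f \<in> borel_measurable (lebesgue_on \<Omega>)"
  by (simp add: bergman_space_def holomorphic_sv_borel_measurable)

section \<open>The Bergman space as a vector space with bounded holomorphic multipliers\<close>

lemma integrable_bergman_product:
  assumes "open \<Omega>" "f \<in> bergman_space \<Omega>" "g \<in> bergman_space \<Omega>"
  shows "integrable (lebesgue_on \<Omega>) (\<lambda>\<xi>. f \<xi> * cnj (g \<xi>))"
proof (rule Bochner_Integration.integrable_bound)
  show "integrable (lebesgue_on \<Omega>) (\<lambda>\<xi>. (cmod (f \<xi>))\<^sup>2 + (cmod (g \<xi>))\<^sup>2)"
    using assms by (simp add: bergman_space_def)
  have "g \<in> borel_measurable (lebesgue_on \<Omega>)" "f \<in> borel_measurable (lebesgue_on \<Omega>)"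
    using assms by (auto intro: bergman_space_borel_measurable)
  then show "(\<lambda>\<xi>. f \<xi> * cnj (g \<xi>)) \<in> borel_measurable (lebesgue_on \<Omega>)"
    by (intro borel_measurable_times measurable_compose[of g _ borel cnj] borel_measurable_continuous_onI
        continuous_on_cnj continuous_on_id)
  have "cmod (f \<xi>) * cmod (g \<xi>) \<le> (cmod (f \<xi>))\<^sup>2 + (cmod (g \<xi>))\<^sup>2" for \<xi>
    using sum_squares_bound[of "cmod (f \<xi>)" "cmod (g \<xi>)"]
      mult_nonneg_nonneg[OF norm_ge_zero norm_ge_zero, of "f \<xi>" "g \<xi>"] by linarith
  then show "AE \<xi> in lebesgue_on \<Omega>. norm (f \<xi> * cnj (g \<xi>)) \<le> norm ((cmod (f \<xi>))\<^sup>2 + (cmod (g \<xi>))\<^sup>2)"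
    by (simp add: norm_mult)
qed

lemma bergman_space_add:
  assumes "open \<Omega>" "f \<in> bergman_space \<Omega>" "g \<in> bergman_space \<Omega>"
  shows "(\<lambda>\<xi>. f \<xi> + g \<xi>) \<in> bergman_space \<Omega>"
proof -
  have "(cmod (f \<xi> + g \<xi>))\<^sup>2 = (cmod (f \<xi>))\<^sup>2 + (cmod (g \<xi>))\<^sup>2 + 2 * Re (f \<xi> * cnj (g \<xi>))" for \<xi>
    unfolding cmod_power2 by (simp add: power2_eq_square algebra_simps)
  moreover have "integrable (lebesgue_on \<Omega>)
      (\<lambda>\<xi>. (cmod (f \<xi>))\<^sup>2 + (cmod (g \<xi>))\<^sup>2 + 2 * Re (f \<xi> * cnj (g \<xi>)))"
    using assms integrable_bergman_product[OF assms]
    by (intro Bochner_Integration.integrable_add integrable_mult_right integrable_Re)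
      (auto simp: bergman_space_def)
  ultimately show ?thesis
    using assms by (auto simp: bergman_space_def holomorphic_sv_add)
qed

text \<open>The squared modulus of the product is dominated by
  \<open>R\<^sup>2 * (cmod (f \<xi>))\<^sup>2\<close>. On a bounded domain this makes the coordinate
  functions multipliers.\<close>

lemma bergman_space_bounded_mult:
  assumes "open \<Omega>" "f \<in> bergman_space \<Omega>" "holomorphic_sv g \<Omega>"
    and bound: "\<And>\<xi>. \<xi> \<in> \<Omega> \<Longrightarrow> cmod (g \<xi>) \<le> R"
  shows "(\<lambda>\<xi>. g \<xi> * f \<xi>) \<in> bergman_space \<Omega>"
proof -
  have "integrable (lebesgue_on \<Omega>) (\<lambda>\<xi>. (cmod (g \<xi> * f \<xi>))\<^sup>2)"
  proof (rule Bochner_Integration.integrable_bound)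
    show "integrable (lebesgue_on \<Omega>) (\<lambda>\<xi>. R\<^sup>2 * (cmod (f \<xi>))\<^sup>2)"
      using assms by (simp add: bergman_space_def)
    have "g \<in> borel_measurable (lebesgue_on \<Omega>)" "f \<in> borel_measurable (lebesgue_on \<Omega>)"
      using assms by (auto intro: bergman_space_borel_measurable holomorphic_sv_borel_measurable)
    then show "(\<lambda>\<xi>. (cmod (g \<xi> * f \<xi>))\<^sup>2) \<in> borel_measurable (lebesgue_on \<Omega>)"
      by measurable
    show "AE \<xi> in lebesgue_on \<Omega>. norm ((cmod (g \<xi> * f \<xi>))\<^sup>2) \<le> norm (R\<^sup>2 * (cmod (f \<xi>))\<^sup>2)"
      by (rule AE_I2) (auto simp: norm_mult power_mult_distrib intro!: mult_right_mono power_mono bound)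
  qed
  then show ?thesis
    using assms by (auto simp: bergman_space_def holomorphic_sv_mult)
qed

lemma bergman_space_scale:
  "open \<Omega> \<Longrightarrow> f \<in> bergman_space \<Omega> \<Longrightarrow> (\<lambda>\<xi>. c * f \<xi>) \<in> bergman_space \<Omega>"
  by (rule bergman_space_bounded_mult[where R = "cmod c"]) (auto simp: holomorphic_sv_const)

lemma bergman_space_sum:
  assumes "open \<Omega>" "\<And>i. i \<in> I \<Longrightarrow> f i \<in> bergman_space \<Omega>"
  shows "(\<lambda>\<xi>. \<Sum>i\<in>I. f i \<xi>) \<in> bergman_space \<Omega>"
proof -
  \<comment> \<open>A sum over an infinite \<open>I\<close> is 0 by convention, so the zero function
    settles that case together with the empty one.\<close>
  have zero: "(\<lambda>_. 0) \<in> bergman_space \<Omega>"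
    by (simp add: bergman_space_def holomorphic_sv_const)
  show ?thesis
    using assms(2)
    by (induction I rule: infinite_finite_induct)
      (simp_all add: zero bergman_space_add \<open>open \<Omega>\<close>)
qed

lemma one_in_bergman_space:
  assumes "open \<Omega>" "bounded \<Omega>"
  shows "(\<lambda>_. 1) \<in> bergman_space \<Omega>"
  using assms finite_measure.integrable_const[OF finite_measure_lebesgue_on[OF lmeasurable_open]]
  by (simp add: bergman_space_def holomorphic_sv_const)

section \<open>The reproducing property and positive semidefinite kernels\<close>

locale bergman_kernel =
  fixes \<Omega> :: "(complex ^ 'n::finite) set" and B
  assumes op: "open \<Omega>" and kernel: "is_bergman_kernel \<Omega> B"
begin

lemma kernel_in_space: "z \<in> \<Omega> \<Longrightarrow> (\<lambda>\<xi>. cnj (B z \<xi>)) \<in> bergman_space \<Omega>"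
  using kernel by (simp add: is_bergman_kernel_def)

lemma reproducing: "z \<in> \<Omega> \<Longrightarrow> f \<in> bergman_space \<Omega> \<Longrightarrow> f z = (LINT \<xi>|lebesgue_on \<Omega>. f \<xi> * B z \<xi>)"
  using kernel by (simp add: is_bergman_kernel_def)

lemma kernel_product_cnj:
  assumes "z \<in> \<Omega>" "w \<in> \<Omega>"
  shows "(LINT \<xi>|lebesgue_on \<Omega>. cnj (B z \<xi>) * B w \<xi>) = cnj (B z w)"
  using reproducing[OF assms(2) kernel_in_space[OF assms(1)]] by simp

text \<open>The kernel is a Gram matrix: both values are inner products of the same two kernel
  functions, taken in opposite orders.\<close>

lemma kernel_hermitian:
  assumes "z \<in> \<Omega>" "w \<in> \<Omega>"
  shows "cnj (B w z) = B z w"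
proof -
  have "B z w = cnj (LINT \<xi>|lebesgue_on \<Omega>. cnj (B z \<xi>) * B w \<xi>)"
    using assms by (simp add: kernel_product_cnj)
  also have "\<dots> = (LINT \<xi>|lebesgue_on \<Omega>. cnj (B w \<xi>) * B z \<xi>)"
    by (subst Bochner_Integration.integral_cnj[symmetric]) (simp only: complex_cnj_mult complex_cnj_cnj mult.commute)
  finally show ?thesis using assms by (simp add: kernel_product_cnj)
qed

lemma kernel_product:
  assumes "z \<in> \<Omega>" "w \<in> \<Omega>"
  shows "(LINT \<xi>|lebesgue_on \<Omega>. cnj (B z \<xi>) * B w \<xi>) = B w z"
  using kernel_product_cnj[OF assms] kernel_hermitian[OF assms(2,1)] by simp

lemma integrable_kernel_product:
  assumes "z \<in> \<Omega>" "w \<in> \<Omega>"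
  shows "integrable (lebesgue_on \<Omega>) (\<lambda>\<xi>. cnj (B z \<xi>) * B w \<xi>)"
  using integrable_bergman_product[OF op kernel_in_space[OF assms(1)] kernel_in_space[OF assms(2)]] by simp

lemma continuous_on_kernel:
  assumes "z \<in> \<Omega>"
  shows "continuous_on \<Omega> (B z)"
proof -
  have "continuous_on \<Omega> (\<lambda>\<xi>. cnj (cnj (B z \<xi>)))"
    using kernel_in_space[OF assms] unfolding bergman_space_def
    by (intro continuous_on_cnj holomorphic_sv_continuous_on) auto
  then show ?thesis by simp
qed

text \<open>The diagonal value is the squared norm of the kernel function. Were it 0, the kernel
  function would vanish almost everywhere and could not reproduce the constant 1, which is square
  integrable because \<open>\<Omega>\<close> is bounded.\<close>

lemma kernel_diagonal:
  assumes "z \<in> \<Omega>" "bounded \<Omega>"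
  shows "Re (B z z) > 0" "B z z = complex_of_real (Re (B z z))"
proof -
  show real: "B z z = complex_of_real (Re (B z z))"
    using kernel_hermitian[OF assms(1) assms(1)] by (simp add: complex_eq_iff)
  have int: "integrable (lebesgue_on \<Omega>) (\<lambda>\<xi>. (cmod (B z \<xi>))\<^sup>2)"
    using kernel_in_space[OF assms(1)] by (simp add: bergman_space_def)
  have "complex_of_real (LINT \<xi>|lebesgue_on \<Omega>. (cmod (B z \<xi>))\<^sup>2) = B z z"
    unfolding kernel_product[OF assms(1) assms(1), symmetric] integral_complex_of_real[symmetric]
    by (simp only: complex_norm_square mult.commute)
  then have eq: "(LINT \<xi>|lebesgue_on \<Omega>. (cmod (B z \<xi>))\<^sup>2) = Re (B z z)"
    by (metis Re_complex_of_real)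
  moreover have "(LINT \<xi>|lebesgue_on \<Omega>. (cmod (B z \<xi>))\<^sup>2) \<noteq> 0"
  proof
    assume "(LINT \<xi>|lebesgue_on \<Omega>. (cmod (B z \<xi>))\<^sup>2) = 0"
    then have "AE \<xi> in lebesgue_on \<Omega>. B z \<xi> = 0"
      using integral_nonneg_eq_0_iff_AE[OF int] by simp
    then have "(LINT \<xi>|lebesgue_on \<Omega>. 1 * B z \<xi>) = 0"
      by (intro integral_eq_zero_AE) auto
    then show False
      using reproducing[OF assms(1) one_in_bergman_space[OF op assms(2)]] by simp
  qed
  moreover have "(LINT \<xi>|lebesgue_on \<Omega>. (cmod (B z \<xi>))\<^sup>2) \<ge> 0"
    by simp
  ultimately show "Re (B z z) > 0" by linarith
qed

text \<open>Writing \<open>B (z i) (z j)\<close> as the integral of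
  \<open>cnj (B (z j) \<xi>) * B (z i) \<xi>\<close> turns the form into an integral over
  \<open>\<xi>\<close> of the form of \<open>T\<close> at the vector
  \<open>d i * B (z i) \<xi>\<close>, which is nonnegative pointwise.\<close>

lemma schur_product_kernel:
  assumes "finite I" and z: "\<And>i. i \<in> I \<Longrightarrow> z i \<in> \<Omega>"
    and psd: "\<And>d. Re (\<Sum>i\<in>I. \<Sum>j\<in>I. d i * cnj (d j) * T i j) \<ge> 0"
  shows "Re (\<Sum>i\<in>I. \<Sum>j\<in>I. d i * cnj (d j) * (T i j * B (z i) (z j))) \<ge> 0"
proof -
  have "(\<Sum>i\<in>I. \<Sum>j\<in>I. d i * cnj (d j) * (T i j * B (z i) (z j)))
      = (\<Sum>i\<in>I. \<Sum>j\<in>I. d i * cnj (d j) * T i j *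
          (LINT \<xi>|lebesgue_on \<Omega>. cnj (B (z j) \<xi>) * B (z i) \<xi>))"
    using z by (intro sum.cong refl) (simp add: kernel_product)
  also have "\<dots> = (LINT \<xi>|lebesgue_on \<Omega>. (\<Sum>i\<in>I. \<Sum>j\<in>I. d i * cnj (d j) * T i j *
          (cnj (B (z j) \<xi>) * B (z i) \<xi>)))"
    using integrable_kernel_product z
    by (simp add: Bochner_Integration.integral_sum)
  also have "Re \<dots> = (LINT \<xi>|lebesgue_on \<Omega>. Re (\<Sum>i\<in>I. \<Sum>j\<in>I. d i * cnj (d j) * T i j *
          (cnj (B (z j) \<xi>) * B (z i) \<xi>)))"
    using integrable_kernel_product z
    by (intro integral_Re[symmetric] Bochner_Integration.integrable_sum integrable_mult_right) auto
  also have "\<dots> \<ge> 0"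
  proof (rule Bochner_Integration.integral_nonneg)
    fix \<xi>
    show "Re (\<Sum>i\<in>I. \<Sum>j\<in>I. d i * cnj (d j) * T i j * (cnj (B (z j) \<xi>) * B (z i) \<xi>)) \<ge> 0"
      using psd[of "\<lambda>i. d i * B (z i) \<xi>"] by (simp add: mult_ac)
  qed
  finally show ?thesis .
qed

lemma kernel_combination_product:
  assumes "finite I" and z: "\<And>i. i \<in> I \<Longrightarrow> z i \<in> \<Omega>" and f: "f \<in> bergman_space \<Omega>"
  shows "(LINT \<xi>|lebesgue_on \<Omega>. f \<xi> * cnj (\<Sum>i\<in>I. c i * cnj (B (z i) \<xi>))) = (\<Sum>i\<in>I. cnj (c i) * f (z i))"
proof -
  have "(LINT \<xi>|lebesgue_on \<Omega>. f \<xi> * cnj (\<Sum>i\<in>I. c i * cnj (B (z i) \<xi>)))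
      = (LINT \<xi>|lebesgue_on \<Omega>. (\<Sum>i\<in>I. cnj (c i) * (f \<xi> * B (z i) \<xi>)))"
    by (simp add: sum_distrib_left mult_ac)
  also have "\<dots> = (\<Sum>i\<in>I. cnj (c i) * (LINT \<xi>|lebesgue_on \<Omega>. f \<xi> * B (z i) \<xi>))"
    using integrable_bergman_product[OF op f kernel_in_space] z
    by (simp add: Bochner_Integration.integral_sum)
  also have "\<dots> = (\<Sum>i\<in>I. cnj (c i) * f (z i))"
    using reproducing f z by (intro sum.cong refl) auto
  finally show ?thesis .
qed

text \<open>Multiplication by \<open>g\<close> has norm at most \<open>R\<close>, hence so has its
  adjoint, which sends \<open>cnj (B z \<xi>)\<close> to \<open>cnj (g z) * cnj (B z \<xi>)\<close>.
  The form is \<open>R\<^sup>2\<close> times the squared norm of a combination \<open>f\<close> of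
  kernel functions minus the squared norm of its image \<open>f'\<close>.\<close>

lemma multiplier_positive_semidefinite:
  assumes "finite I" and z: "\<And>i. i \<in> I \<Longrightarrow> z i \<in> \<Omega>"
    and g: "holomorphic_sv g \<Omega>" and bound: "\<And>\<xi>. \<xi> \<in> \<Omega> \<Longrightarrow> cmod (g \<xi>) \<le> R" and "R > 0"
  shows "Re (\<Sum>i\<in>I. \<Sum>j\<in>I. d i * cnj (d j) *
      ((complex_of_real (R\<^sup>2) - g (z i) * cnj (g (z j))) * B (z i) (z j))) \<ge> 0"
proof -
  define f where "f \<xi> = (\<Sum>i\<in>I. cnj (d i) * cnj (B (z i) \<xi>))" for \<xi>
  define f' where "f' \<xi> = (\<Sum>i\<in>I. cnj (d i * g (z i)) * cnj (B (z i) \<xi>))" for \<xi>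
  let ?M = "lebesgue_on \<Omega>"
  have f: "f \<in> bergman_space \<Omega>" and f': "f' \<in> bergman_space \<Omega>"
    unfolding f_def f'_def using z
    by (auto intro!: bergman_space_sum bergman_space_scale op kernel_in_space)
  have gf': "(\<lambda>\<xi>. g \<xi> * f' \<xi>) \<in> bergman_space \<Omega>"
    by (rule bergman_space_bounded_mult[OF op f' g bound])
  have ff: "(LINT \<xi>|?M. f \<xi> * cnj (f \<xi>)) = (\<Sum>i\<in>I. \<Sum>j\<in>I. d i * cnj (d j) * B (z i) (z j))"
  proof -
    have "(LINT \<xi>|?M. f \<xi> * cnj (f \<xi>)) = (\<Sum>i\<in>I. d i * f (z i))"
      using kernel_combination_product[OF assms(1) z f, where c = "\<lambda>i. cnj (d i)"] by (simp add: f_def)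
    also have "\<dots> = (\<Sum>i\<in>I. \<Sum>j\<in>I. d i * cnj (d j) * B (z i) (z j))"
      unfolding f_def sum_distrib_left
      using z by (intro sum.cong refl) (simp add: mult.assoc kernel_hermitian)
    finally show ?thesis .
  qed
  have f'f': "(LINT \<xi>|?M. f' \<xi> * cnj (f' \<xi>)) =
      (\<Sum>i\<in>I. \<Sum>j\<in>I. d i * cnj (d j) * (g (z i) * cnj (g (z j)) * B (z i) (z j)))"
  proof -
    have "(LINT \<xi>|?M. f' \<xi> * cnj (f' \<xi>)) = (\<Sum>i\<in>I. d i * g (z i) * f' (z i))"
      using kernel_combination_product[OF assms(1) z f', where c = "\<lambda>i. cnj (d i * g (z i))"] by (simp add: f'_def)
    also have "\<dots> = (\<Sum>i\<in>I. \<Sum>j\<in>I. d i * cnj (d j) * (g (z i) * cnj (g (z j)) * B (z i) (z j)))"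
      unfolding f'_def sum_distrib_left
      using z by (intro sum.cong refl) (simp add: mult_ac kernel_hermitian)
    finally show ?thesis .
  qed
  \<comment> \<open>\<open>f'\<close> is the image of \<open>f\<close> under the adjoint of multiplication by \<open>g\<close>.\<close>
  have adj: "(LINT \<xi>|?M. g \<xi> * f' \<xi> * cnj (f \<xi>)) = (LINT \<xi>|?M. f' \<xi> * cnj (f' \<xi>))"
  proof -
    have "(LINT \<xi>|?M. g \<xi> * f' \<xi> * cnj (f \<xi>)) = (\<Sum>i\<in>I. d i * (g (z i) * f' (z i)))"
      using kernel_combination_product[OF assms(1) z gf', where c = "\<lambda>i. cnj (d i)"] by (simp add: f_def)
    moreover have "(LINT \<xi>|?M. f' \<xi> * cnj (f' \<xi>)) = (\<Sum>i\<in>I. d i * g (z i) * f' (z i))"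
      using kernel_combination_product[OF assms(1) z f', where c = "\<lambda>i. cnj (d i * g (z i))"] by (simp add: f'_def)
    ultimately show ?thesis by (simp add: mult.assoc)
  qed
  \<comment> \<open>Expand the squared modulus of \<open>R\<^sup>2 * f - g * f'\<close> and bound
    that of \<open>g * f'\<close> by \<open>R\<^sup>2\<close> times that of \<open>f'\<close>.
    Integrated, this replaces an operator norm argument for the adjoint.\<close>
  have pointwise: "0 \<le> Re (complex_of_real (R^4) * (f \<xi> * cnj (f \<xi>)) + complex_of_real (R\<^sup>2) * (f' \<xi> * cnj (f' \<xi>))
      - complex_of_real (2 * R\<^sup>2) * (g \<xi> * f' \<xi> * cnj (f \<xi>)))" if "\<xi> \<in> \<Omega>" for \<xi>
  proof -
    have "0 \<le> (cmod (complex_of_real (R\<^sup>2) * f \<xi> - g \<xi> * f' \<xi>))\<^sup>2" by simp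
    also have "\<dots> = R^4 * (cmod (f \<xi>))\<^sup>2 - 2 * R\<^sup>2 * Re (g \<xi> * f' \<xi> * cnj (f \<xi>)) + (cmod (g \<xi> * f' \<xi>))\<^sup>2"
      unfolding cmod_power2 by (simp add: power2_eq_square power4_eq_xxxx algebra_simps)
    also have "(cmod (g \<xi> * f' \<xi>))\<^sup>2 \<le> R\<^sup>2 * (cmod (f' \<xi>))\<^sup>2"
      using bound[OF that] by (auto simp: norm_mult power_mult_distrib intro!: mult_right_mono power_mono)
    finally show ?thesis
      by (simp add: complex_norm_square[symmetric] del: Re_complex_of_real flip: of_real_power of_real_mult)
         (simp add: complex_mult_cnj cmod_power2)
  qed
  have int: "integrable ?M (\<lambda>\<xi>. f \<xi> * cnj (f \<xi>))" "integrable ?M (\<lambda>\<xi>. f' \<xi> * cnj (f' \<xi>))"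
      "integrable ?M (\<lambda>\<xi>. g \<xi> * f' \<xi> * cnj (f \<xi>))"
    using integrable_bergman_product[OF op] f f' gf' by blast+
  let ?h = "\<lambda>\<xi>. complex_of_real (R^4) * (f \<xi> * cnj (f \<xi>)) + complex_of_real (R\<^sup>2) * (f' \<xi> * cnj (f' \<xi>))
      - complex_of_real (2 * R\<^sup>2) * (g \<xi> * f' \<xi> * cnj (f \<xi>))"
  have "0 \<le> (LINT \<xi>|?M. Re (?h \<xi>))"
    by (rule integral_nonneg_AE, rule AE_I2, rule pointwise) simp
  also have "\<dots> = Re (LINT \<xi>|?M. ?h \<xi>)"
    using int by (intro integral_Re) auto
  also have "(LINT \<xi>|?M. ?h \<xi>) = complex_of_real (R^4) * (LINT \<xi>|?M. f \<xi> * cnj (f \<xi>))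
      + complex_of_real (R\<^sup>2) * (LINT \<xi>|?M. f' \<xi> * cnj (f' \<xi>))
      - complex_of_real (2 * R\<^sup>2) * (LINT \<xi>|?M. g \<xi> * f' \<xi> * cnj (f \<xi>))"
    using int by (simp del: of_real_power of_real_mult)
  \<comment> \<open>By \<open>adj\<close> the cross term is a multiple of the squared norm of
    \<open>f'\<close>; the coefficients \<open>R\<^sup>2\<close> and \<open>- 2 * R\<^sup>2\<close>
    leave \<open>- R\<^sup>2\<close>, so a positive factor splits off.\<close>
  also have "\<dots> = complex_of_real (R\<^sup>2) * (complex_of_real (R\<^sup>2) * (LINT \<xi>|?M. f \<xi> * cnj (f \<xi>)) -
       (LINT \<xi>|?M. f' \<xi> * cnj (f' \<xi>)))"
    unfolding adj by (simp add: power2_eq_square power4_eq_xxxx algebra_simps)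
  also have "Re \<dots> = R\<^sup>2 * Re (complex_of_real (R\<^sup>2) * (LINT \<xi>|?M. f \<xi> * cnj (f \<xi>)) -
       (LINT \<xi>|?M. f' \<xi> * cnj (f' \<xi>)))"
    by simp
  finally have "0 \<le> Re (complex_of_real (R\<^sup>2) * (LINT \<xi>|?M. f \<xi> * cnj (f \<xi>)) - (LINT \<xi>|?M. f' \<xi> * cnj (f' \<xi>)))"
    using \<open>R > 0\<close> by (simp add: zero_le_mult_iff)
  also have "complex_of_real (R\<^sup>2) * (LINT \<xi>|?M. f \<xi> * cnj (f \<xi>)) - (LINT \<xi>|?M. f' \<xi> * cnj (f' \<xi>))
     = (\<Sum>i\<in>I. \<Sum>j\<in>I. d i * cnj (d j) *
      ((complex_of_real (R\<^sup>2) - g (z i) * cnj (g (z j))) * B (z i) (z j)))"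
    unfolding ff f'f' by (simp add: sum_distrib_left sum_subtractf algebra_simps)
  finally show ?thesis .
qed

text \<open>The conjugate of a positive semidefinite kernel is again one, by conjugating the
  weights. The Schur product of the conjugated multiplier kernel with \<open>B\<close> turns
  \<open>cnj B * B\<close> into the squared modulus, and real weights leave only the real part of
  the factor in \<open>g\<close>.\<close>

lemma norm_square_kernel_multiplier_positive_semidefinite:
  fixes a :: "'i \<Rightarrow> real"
  assumes "finite I" and z: "\<And>i. i \<in> I \<Longrightarrow> z i \<in> \<Omega>"
    and g: "holomorphic_sv g \<Omega>" and bound: "\<And>\<xi>. \<xi> \<in> \<Omega> \<Longrightarrow> cmod (g \<xi>) \<le> R" and "R > 0"
  shows "(\<Sum>i\<in>I. \<Sum>j\<in>I. a i * a j * (R\<^sup>2 - Re (g (z i) * cnj (g (z j)))) * (cmod (B (z i) (z j)))\<^sup>2) \<ge> 0"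
proof -
  have "0 \<le> Re (\<Sum>i\<in>I. \<Sum>j\<in>I. complex_of_real (a i) * cnj (complex_of_real (a j)) *
     (cnj ((complex_of_real (R\<^sup>2) - g (z i) * cnj (g (z j))) * B (z i) (z j)) * B (z i) (z j)))"
  proof (rule schur_product_kernel[OF assms(1) z])
    fix d :: "'i \<Rightarrow> complex"
    show "0 \<le> Re (\<Sum>i\<in>I. \<Sum>j\<in>I. d i * cnj (d j) *
       cnj ((complex_of_real (R\<^sup>2) - g (z i) * cnj (g (z j))) * B (z i) (z j)))"
      using multiplier_positive_semidefinite[OF assms(1) z g bound \<open>R > 0\<close>, where d = "\<lambda>i. cnj (d i)"]
      by (subst cnj.sel(1)[symmetric]) (simp only: cnj_sum complex_cnj_mult complex_cnj_cnj)
  qed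
  also have "(\<lambda>i j. cnj ((complex_of_real (R\<^sup>2) - g (z i) * cnj (g (z j))) * B (z i) (z j)) * B (z i) (z j))
     = (\<lambda>i j. cnj (complex_of_real (R\<^sup>2) - g (z i) * cnj (g (z j))) * complex_of_real ((cmod (B (z i) (z j)))\<^sup>2))"
    by (intro ext) (simp only: complex_norm_square complex_cnj_mult mult_ac)
  finally show ?thesis
    by (simp add: mult_ac)
qed

lemma norm_square_kernel_positive_semidefinite:
  fixes a :: "'i \<Rightarrow> real"
  assumes "finite I" and z: "\<And>i. i \<in> I \<Longrightarrow> z i \<in> \<Omega>"
  shows "(\<Sum>i\<in>I. \<Sum>j\<in>I. a i * a j * (cmod (B (z i) (z j)))\<^sup>2) \<ge> 0"
  using norm_square_kernel_multiplier_positive_semidefinite[OF assms(1) z holomorphic_sv_const[of 0], where R = 1 and a = a]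
  by simp

end

section \<open>Exponential families\<close>

text \<open>The points of \<open>S\<close> where the functions differ form an open set of measure
  zero, which must be empty.\<close>

lemma AE_lebesgue_on_continuous_eq:
  fixes f g :: "'a::euclidean_space \<Rightarrow> 'b::real_normed_vector"
  assumes "AE x in lebesgue_on \<Omega>. f x = g x" and "\<Omega> \<in> sets lebesgue"
    and "open S" "S \<subseteq> \<Omega>" "continuous_on S f" "continuous_on S g" and "x \<in> S"
  shows "f x = g x"
proof -
  have "AE x in lebesgue. x \<in> \<Omega> \<longrightarrow> f x = g x"
    using assms(1,2) by (simp add: AE_restrict_space_iff)
  then obtain N where "negligible N" and N: "{x. \<not> (x \<in> \<Omega> \<longrightarrow> f x = g x)} \<subseteq> N"
    unfolding eventually_ae_filter_negligible by auto
  have "open {x \<in> S. f x - g x \<in> - {0}}"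
    by (intro continuous_open_preimage[unfolded vimage_def Int_def mem_Collect_eq] continuous_on_diff assms) auto
  moreover have "negligible {x \<in> S. f x - g x \<in> - {0}}"
    using N \<open>S \<subseteq> \<Omega>\<close> by (intro negligible_subset[OF \<open>negligible N\<close>]) auto
  ultimately have "{x \<in> S. f x - g x \<in> - {0}} = {}"
    using open_not_negligible by blast
  then show ?thesis using \<open>x \<in> S\<close> by auto
qed

section \<open>The kernel of a model that is an exponential family\<close>

context bergman_kernel
begin

lemma norm_kernel_commute: "z \<in> \<Omega> \<Longrightarrow> w \<in> \<Omega> \<Longrightarrow> cmod (B z w) = cmod (B w z)"
  using kernel_hermitian[of z w] by (metis complex_mod_cnj)

text \<open>Densities with respect to a finite measure are unique up to null sets, and Lebesgue
  measure on the bounded set \<open>\<Omega>\<close> is finite.\<close>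

lemma exponential_family_AE:
  assumes "bounded \<Omega>" "z \<in> \<Omega>"
    and meas: "(\<lambda>\<xi>. exp (h \<xi>)) \<in> borel_measurable (lebesgue_on \<Omega>)"
    and eq: "bergman_model \<Omega> B z = density (lebesgue_on \<Omega>) (\<lambda>\<xi>. ennreal (exp (h \<xi>)))"
  shows "AE \<xi> in lebesgue_on \<Omega>. (cmod (B z \<xi>))\<^sup>2 = Re (B z z) * exp (h \<xi>)"
proof -
  interpret finite_measure "lebesgue_on \<Omega>"
    by (intro finite_measure_lebesgue_on lmeasurable_open \<open>bounded \<Omega>\<close> op)
  have pos: "Re (B z z) > 0" using assms by (intro kernel_diagonal)
  have "B z \<in> borel_measurable (lebesgue_on \<Omega>)"
    using continuous_on_kernel[OF \<open>z \<in> \<Omega>\<close>] op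
    by (intro continuous_imp_measurable_on_sets_lebesgue) auto
  then have "AE \<xi> in lebesgue_on \<Omega>. ennreal (bergman_density B z \<xi>) = ennreal (exp (h \<xi>))"
    using eq unfolding bergman_model_def
    by (intro density_unique measurable_compose[OF meas measurable_ennreal]
         measurable_compose[OF _ measurable_ennreal]) (auto simp: bergman_density_def)
  then show ?thesis
  proof eventually_elim
    case (elim \<xi>)
    moreover have "bergman_density B z \<xi> \<ge> 0"
      using pos by (simp add: bergman_density_def)
    ultimately have "bergman_density B z \<xi> = exp (h \<xi>)" by simp
    then show ?case using pos by (simp add: bergman_density_def field_simps)
  qed
qed

text \<open>Along a segment in the coordinates the unknown functions on the sample space cancel, and
  the resulting relation, valid almost everywhere, extends by continuity.\<close>

lemma log_affine_kernel:
  assumes "bounded \<Omega>" and z: "z\<^sub>0 \<in> \<Omega>" "z\<^sub>1 \<in> \<Omega>" "z\<^sub>2 \<in> \<Omega>"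
    and ae: "\<And>z. z \<in> \<Omega> \<Longrightarrow> AE \<xi> in lebesgue_on \<Omega>.
        (cmod (B z \<xi>))\<^sup>2 = Re (B z z) * exp (C \<xi> + (\<Sum>b\<in>Basis. (x z \<bullet> b) * F b \<xi>) - \<psi> z)"
    and x: "x z\<^sub>2 = (1 - \<theta>) *\<^sub>R x z\<^sub>0 + \<theta> *\<^sub>R x z\<^sub>1"
  shows "\<exists>k. \<forall>\<xi>\<in>\<Omega>. B z\<^sub>0 \<xi> \<noteq> 0 \<longrightarrow> B z\<^sub>1 \<xi> \<noteq> 0 \<longrightarrow>
      (cmod (B z\<^sub>2 \<xi>))\<^sup>2 = exp (k + (1 - \<theta>) * ln ((cmod (B z\<^sub>0 \<xi>))\<^sup>2) + \<theta> * ln ((cmod (B z\<^sub>1 \<xi>))\<^sup>2))"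
proof -
  \<comment> \<open>\<open>L z\<close> is the part of \<open>ln ((cmod (B z \<xi>))\<^sup>2)\<close>
    that depends on \<open>z\<close> alone, and \<open>k\<close> measures its failure to be affine
    along the segment.\<close>
  define L where "L z = ln (Re (B z z)) - \<psi> z" for z
  define k where "k = L z\<^sub>2 - (1 - \<theta>) * L z\<^sub>0 - \<theta> * L z\<^sub>1"
  let ?f = "\<lambda>\<xi>. (cmod (B z\<^sub>2 \<xi>))\<^sup>2"
  let ?g = "\<lambda>\<xi>. exp (k + (1 - \<theta>) * ln ((cmod (B z\<^sub>0 \<xi>))\<^sup>2) + \<theta> * ln ((cmod (B z\<^sub>1 \<xi>))\<^sup>2))"
  have AE_exp: "AE \<xi> in lebesgue_on \<Omega>. (cmod (B z \<xi>))\<^sup>2 = exp (L z + C \<xi> + (\<Sum>b\<in>Basis. (x z \<bullet> b) * F b \<xi>))"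
    if "z \<in> \<Omega>" for z
    using ae[OF that]
  proof eventually_elim
    case (elim \<xi>)
    have "Re (B z z) = exp (ln (Re (B z z)))"
      using kernel_diagonal(1)[OF that \<open>bounded \<Omega>\<close>] by simp
    then show ?case unfolding elim L_def by (simp add: exp_add exp_diff)
  qed
  have lin: "(\<Sum>b\<in>Basis. (x z\<^sub>2 \<bullet> b) * F b \<xi>)
     = (1 - \<theta>) * (\<Sum>b\<in>Basis. (x z\<^sub>0 \<bullet> b) * F b \<xi>) + \<theta> * (\<Sum>b\<in>Basis. (x z\<^sub>1 \<bullet> b) * F b \<xi>)" for \<xi>
    unfolding x sum_distrib_left sum.distrib[symmetric]
    by (intro sum.cong refl) (simp add: inner_add_left algebra_simps)
  have AE_eq: "AE \<xi> in lebesgue_on \<Omega>. ?f \<xi> = ?g \<xi>"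
    using AE_exp[OF z(1)] AE_exp[OF z(2)] AE_exp[OF z(3)]
  proof eventually_elim
    case (elim \<xi>)
    \<comment> \<open>The weights \<open>1 - \<theta>\<close> and \<open>\<theta>\<close> add up to
      1, so \<open>C \<xi>\<close> cancels.\<close>
    show ?case unfolding elim ln_exp lin k_def by (simp add: algebra_simps)
  qed
  \<comment> \<open>Off the zeros of the two kernel functions the logarithms are continuous, so the
    equation extends from almost every point to every point.\<close>
  let ?S = "{\<xi> \<in> \<Omega>. B z\<^sub>0 \<xi> * B z\<^sub>1 \<xi> \<in> - {0}}"
  have "open ?S"
    by (intro continuous_open_preimage[unfolded vimage_def Int_def mem_Collect_eq] continuous_on_mult
        continuous_on_kernel z op) auto
  have "?f \<xi> = ?g \<xi>" if "\<xi> \<in> \<Omega>" "B z\<^sub>0 \<xi> \<noteq> 0" "B z\<^sub>1 \<xi> \<noteq> 0" for \<xi>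
  proof (rule AE_lebesgue_on_continuous_eq[OF AE_eq _ \<open>open ?S\<close>])
    have cont: "continuous_on ?S (B z)" if "z \<in> \<Omega>" for z
      by (rule continuous_on_subset[OF continuous_on_kernel[OF that]]) auto
    show "continuous_on ?S ?f"
      by (intro continuous_intros cont z)
    show "continuous_on ?S ?g"
      by (intro continuous_intros cont z) auto
  qed (use that op in auto)
  then show ?thesis by blast
qed

text \<open>The affine relation through \<open>\<gamma> 0\<close>, \<open>\<gamma> s\<close> and
  \<open>\<gamma> t\<close> makes the exponent affine in \<open>t\<close>, with slope
  \<open>g s\<close> after normalisation. Symmetry of the modulus of \<open>B\<close> gives
  \<open>t * g s = s * g t\<close>, so \<open>g\<close> is linear, and positive semidefiniteness at
  two points fixes the sign of \<open>c\<close>.\<close>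

lemma kernel_along_coordinate_line:
  fixes x :: "complex ^ 'n \<Rightarrow> complex ^ 'n"
  assumes "bounded \<Omega>"
    and ae: "\<And>z. z \<in> \<Omega> \<Longrightarrow> AE \<xi> in lebesgue_on \<Omega>.
        (cmod (B z \<xi>))\<^sup>2 = Re (B z z) * exp (C \<xi> + (\<Sum>b\<in>Basis. (x z \<bullet> b) * F b \<xi>) - \<psi> z)"
    and "\<epsilon> > 0"
    and \<gamma>: "\<And>t. \<bar>t\<bar> < \<epsilon> \<Longrightarrow> \<gamma> t \<in> \<Omega>" "\<And>t. \<bar>t\<bar> < \<epsilon> \<Longrightarrow> x (\<gamma> t) = x\<^sub>0 + t *\<^sub>R a"
      "\<And>t. \<bar>t\<bar> < \<epsilon> \<Longrightarrow> B (\<gamma> 0) (\<gamma> t) \<noteq> 0"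
  shows "\<exists>c \<alpha>. c \<ge> 0 \<and> (\<forall>t. \<bar>t\<bar> < \<epsilon> \<longrightarrow> \<alpha> t > (0::real)) \<and>
    (\<forall>t s. \<bar>t\<bar> < \<epsilon> \<longrightarrow> \<bar>s\<bar> < \<epsilon> \<longrightarrow> (cmod (B (\<gamma> t) (\<gamma> s)))\<^sup>2 = \<alpha> t * \<alpha> s * exp (c * t * s))"
proof -
  define p where "p = \<gamma> 0"
  define u where "u t = ln ((cmod (B p (\<gamma> t)))\<^sup>2)" for t
  \<comment> \<open>Subtracting \<open>u 0 / 2\<close> shares the value at \<open>t = s = 0\<close>
    equally between the two factors: \<open>\<alpha> 0 * \<alpha> 0 = exp (u 0)\<close>.\<close>
  define \<alpha> where "\<alpha> t = exp (u t - u 0 / 2)" for t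
  define g where "g s = (ln ((cmod (B (\<gamma> s) (\<gamma> s)))\<^sup>2) - 2 * u s + u 0) / s" for s
  \<comment> \<open>\<open>g 0 = 0\<close> through division by zero, which is the value needed at \<open>s = 0\<close>.\<close>
  have p: "p \<in> \<Omega>" using \<gamma>(1)[of 0] \<open>\<epsilon> > 0\<close> by (simp add: p_def)
  have exp_u: "exp (u t) = (cmod (B p (\<gamma> t)))\<^sup>2" if "\<bar>t\<bar> < \<epsilon>" for t
    using \<gamma>(3)[OF that] by (simp add: u_def p_def)
  have main: "(cmod (B (\<gamma> t) (\<gamma> s)))\<^sup>2 = \<alpha> t * \<alpha> s * exp (t * g s)" if t: "\<bar>t\<bar> < \<epsilon>" and s: "\<bar>s\<bar> < \<epsilon>" for t s
  proof (cases "s = 0")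
    case True
    have "(cmod (B (\<gamma> t) (\<gamma> s)))\<^sup>2 = exp (u t)"
      unfolding exp_u[OF t] True using norm_kernel_commute \<gamma>(1)[OF t] p by (simp add: p_def)
    then show ?thesis by (simp add: True g_def \<alpha>_def mult_exp_exp)
  next
    case False
    have segment: "x (\<gamma> t) = (1 - t / s) *\<^sub>R x p + (t / s) *\<^sub>R x (\<gamma> s)"
      using \<gamma>(2)[OF t] \<gamma>(2)[OF s] \<gamma>(2)[of 0] \<open>\<epsilon> > 0\<close> False
      by (simp add: p_def algebra_simps scaleR_left_diff_distrib)
    obtain k where k: "\<And>\<xi>. \<xi> \<in> \<Omega> \<Longrightarrow> B p \<xi> \<noteq> 0 \<Longrightarrow> B (\<gamma> s) \<xi> \<noteq> 0 \<Longrightarrow>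
      (cmod (B (\<gamma> t) \<xi>))\<^sup>2 = exp (k + (1 - t / s) * ln ((cmod (B p \<xi>))\<^sup>2) + t / s * ln ((cmod (B (\<gamma> s) \<xi>))\<^sup>2))"
      using log_affine_kernel[OF \<open>bounded \<Omega>\<close> p \<gamma>(1)[OF s] \<gamma>(1)[OF t] ae segment] by blast
    have nz: "B z z \<noteq> 0" if "z \<in> \<Omega>" for z
      using kernel_diagonal(1)[OF that \<open>bounded \<Omega>\<close>] by auto
    have comm: "cmod (B (\<gamma> r) p) = cmod (B p (\<gamma> r))" if "\<bar>r\<bar> < \<epsilon>" for r
      using norm_kernel_commute \<gamma>(1)[OF that] p by simp
    have "B (\<gamma> s) p \<noteq> 0"
      using comm[OF s] \<gamma>(3)[OF s] by (auto simp: p_def)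
    \<comment> \<open>Evaluating at the sample point \<open>p\<close> determines the unknown
      \<open>k\<close>; the sample point \<open>\<gamma> s\<close> then gives the wanted
      value.\<close>
    then have "exp (u t) = exp (k + (1 - t / s) * u 0 + t / s * u s)"
      using k[OF p nz[OF p]] comm[OF t] comm[OF s] exp_u[OF t] by (simp add: u_def p_def)
    then have "k = u t - (1 - t / s) * u 0 - t / s * u s" by simp
    moreover have "(cmod (B (\<gamma> t) (\<gamma> s)))\<^sup>2 = exp (k + (1 - t / s) * u s + t / s * ln ((cmod (B (\<gamma> s) (\<gamma> s)))\<^sup>2))"
      using k[OF \<gamma>(1)[OF s]] \<gamma>(3)[OF s] nz[OF \<gamma>(1)[OF s]] by (simp add: u_def p_def)
    \<comment> \<open>The coefficient of \<open>t / s\<close> collects to the numerator of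
      \<open>g s\<close>; the remaining terms are \<open>u t + u s - u 0\<close>.\<close>
    moreover have "u t - (1 - t / s) * u 0 - t / s * u s + (1 - t / s) * u s + t / s * ln ((cmod (B (\<gamma> s) (\<gamma> s)))\<^sup>2)
       = (u t - u 0 / 2) + (u s - u 0 / 2) + t * g s"
      using False by (simp add: g_def field_simps)
    ultimately show ?thesis by (simp only: \<alpha>_def mult_exp_exp)
  qed
  have \<alpha>_pos: "\<alpha> t > 0" for t by (simp add: \<alpha>_def)
  \<comment> \<open>Any nonzero reference point in the interval serves to read off the slope
    \<open>c\<close> of \<open>g\<close>.\<close>
  define r where "r = \<epsilon> / 2"
  define c where "c = g r / r"
  have r: "r > 0" "\<bar>r\<bar> < \<epsilon>" using \<open>\<epsilon> > 0\<close> by (auto simp: r_def)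
  have g: "g s = c * s" if "\<bar>s\<bar> < \<epsilon>" for s
  proof -
    have "\<alpha> r * \<alpha> s * exp (r * g s) = \<alpha> r * \<alpha> s * exp (s * g r)"
      using main[OF r(2) that] main[OF that r(2)] norm_kernel_commute[OF \<gamma>(1)[OF that] \<gamma>(1)[OF r(2)]]
      by (simp add: mult_ac)
    then have "r * g s = s * g r" using \<alpha>_pos[of r] \<alpha>_pos[of s] by simp
    then show ?thesis using r by (simp add: c_def field_simps)
  qed
  have eq: "(cmod (B (\<gamma> t) (\<gamma> s)))\<^sup>2 = \<alpha> t * \<alpha> s * exp (c * t * s)" if "\<bar>t\<bar> < \<epsilon>" "\<bar>s\<bar> < \<epsilon>" for t s
    using main[OF that] g[OF that(2)] by (simp add: mult_ac)
  have "c \<ge> 0"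
  proof -
    have "\<bar>q\<bar> < \<epsilon>" if "q \<in> {0, r}" for q using that r \<open>\<epsilon> > 0\<close> by auto
    \<comment> \<open>With weights \<open>-1 / \<alpha> 0\<close> and \<open>1 / \<alpha> r\<close>
      the factors \<open>\<alpha>\<close> cancel, leaving
      \<open>1 - 2 + exp (c * r * r)\<close>.\<close>
    then have "0 \<le> (\<Sum>i\<in>{0, r}. \<Sum>j\<in>{0, r}. (if i = 0 then - 1 / \<alpha> i else 1 / \<alpha> i) *
        (if j = 0 then - 1 / \<alpha> j else 1 / \<alpha> j) * (cmod (B (\<gamma> i) (\<gamma> j)))\<^sup>2)"
      using \<gamma>(1) by (intro norm_square_kernel_positive_semidefinite) blast+
    also have "\<dots> = exp (c * r * r) - 1"
      using r \<open>\<epsilon> > 0\<close> \<alpha>_pos[of r] \<alpha>_pos[of 0] by (simp add: eq)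
    finally have "0 \<le> c * (r * r)" by (simp add: mult.assoc)
    then show ?thesis using mult_pos_pos[OF r(1) r(1)] unfolding zero_le_mult_iff by linarith
  qed
  with \<alpha>_pos eq show ?thesis by blast
qed

end

theorem corollary3p23:
  fixes \<Omega> :: "(complex ^ 'n::finite) set"
    and B :: "complex ^ 'n \<Rightarrow> complex ^ 'n \<Rightarrow> complex"
  assumes "open \<Omega>" and "connected \<Omega>" and "\<Omega> \<noteq> {}" and "bounded \<Omega>"
    and "is_bergman_kernel \<Omega> B"
    and "condition_C 6 \<Omega> B"
  shows "\<not> exponential_family \<Omega> (lebesgue_on \<Omega>) (bergman_model \<Omega> B)"
proof
  interpret bergman_kernel \<Omega> B
    using assms by unfold_locales
  assume "exponential_family \<Omega> (lebesgue_on \<Omega>) (bergman_model \<Omega> B)"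
  then obtain x C F \<psi> where coord: "coordinate_system \<Omega> x"
    and fam: "\<And>z. z \<in> \<Omega> \<Longrightarrow>
        (\<lambda>\<xi>. exp (C \<xi> + (\<Sum>b\<in>Basis. (x z \<bullet> b) * F b \<xi>) - \<psi> z)) \<in> borel_measurable (lebesgue_on \<Omega>) \<and>
        bergman_model \<Omega> B z = density (lebesgue_on \<Omega>)
          (\<lambda>\<xi>. ennreal (exp (C \<xi> + (\<Sum>b\<in>Basis. (x z \<bullet> b) * F b \<xi>) - \<psi> z)))"
    unfolding exponential_family_def by blast
  have ae: "AE \<xi> in lebesgue_on \<Omega>.
        (cmod (B z \<xi>))\<^sup>2 = Re (B z z) * exp (C \<xi> + (\<Sum>b\<in>Basis. (x z \<bullet> b) * F b \<xi>) - \<psi> z)"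
    if "z \<in> \<Omega>" for z
    using fam[OF that] by (intro exponential_family_AE \<open>bounded \<Omega>\<close> that) auto
  obtain p where p: "p \<in> \<Omega>" using \<open>\<Omega> \<noteq> {}\<close> by blast
  let ?y = "inv_into \<Omega> x"
  have inj: "inj_on x \<Omega>" and op_x: "open (x ` \<Omega>)"
    using coord by (auto simp: coordinate_system_def)
  have "Ck_on (Suc 0) x \<Omega>" "Ck_on (Suc 0) ?y (x ` \<Omega>)"
    using coord unfolding coordinate_system_def smooth_on_def by blast+
  then obtain D A where D: "(x has_derivative D) (at p)" and A: "(?y has_derivative A) (at (x p))"
    using p unfolding Ck_on.simps differentiable_def by blast
  have inv: "?y (x z) = z" if "z \<in> \<Omega>" for z
    using inj that by (rule inv_into_f_f)
  \<comment> \<open>Differentiating \<open>?y (x z) = z\<close> at \<open>p\<close> shows that every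
    direction \<open>v\<close> is attained by a line in the coordinates, namely the one with
    direction \<open>D v\<close>.\<close>
  have AD: "A (D v) = v" for v
  proof -
    have "((\<lambda>z. ?y (x z)) has_derivative (\<lambda>v. A (D v))) (at p)"
      using diff_chain_at[OF D A] by (simp add: o_def)
    moreover have "((\<lambda>z. ?y (x z)) has_derivative (\<lambda>v. v)) (at p)"
      by (rule has_derivative_transform_within_open[OF has_derivative_ident \<open>open \<Omega>\<close> p]) (simp add: inv)
    ultimately have "(\<lambda>v. A (D v)) = (\<lambda>v. v)" by (rule has_derivative_unique)
    then show ?thesis by metis
  qed
  obtain k :: 'n where True by blast
  define v :: "complex ^ 'n" where "v = axis k 1"
  \<comment> \<open>The curve follows a coordinate line through \<open>x p\<close>; by
    \<open>AD\<close> its velocity at 0 is \<open>v\<close>, so its \<open>k\<close>-th component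
    has derivative 1.\<close>
  define \<gamma> where "\<gamma> t = ?y (x p + t *\<^sub>R D v)" for t
  have \<gamma>0: "\<gamma> 0 = p" by (simp add: \<gamma>_def inv p)
  have "((\<lambda>t. x p + t *\<^sub>R D v) has_vector_derivative D v) (at 0)"
    by (auto intro!: derivative_eq_intros)
  then have \<gamma>': "(\<gamma> has_vector_derivative v) (at 0)"
    using vector_derivative_diff_chain_within[of "\<lambda>t. x p + t *\<^sub>R D v" "D v" 0 UNIV ?y A] A AD
    by (simp add: o_def \<gamma>_def[abs_def] has_derivative_at_withinI)
  have coord': "((\<lambda>t. \<gamma> t $ k) has_vector_derivative 1) (at 0)"
    using bounded_linear.has_vector_derivative[OF bounded_linear_vec_nth \<gamma>', of k] by (simp add: v_def)
  have "isCont \<gamma> 0"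
    using \<gamma>' by (rule has_vector_derivative_continuous)
  \<comment> \<open>The coordinate image is open, and \<open>B p\<close> is continuous with
    \<open>B p p\<close> nonzero, so both properties persist near \<open>t = 0\<close>.\<close>
  have "\<forall>\<^sub>F t in nhds 0. x p + t *\<^sub>R D v \<in> x ` \<Omega> \<and> B p (\<gamma> t) \<noteq> 0"
  proof (rule eventually_conj)
    have "((\<lambda>t. x p + t *\<^sub>R D v) \<longlongrightarrow> x p + 0 *\<^sub>R D v) (nhds 0)"
      by (intro tendsto_intros filterlim_ident)
    then show "\<forall>\<^sub>F t in nhds 0. x p + t *\<^sub>R D v \<in> x ` \<Omega>"
      using op_x p by (intro topological_tendstoD) auto
    have "open {\<xi> \<in> \<Omega>. B p \<xi> \<in> - {0}}"
      by (intro continuous_open_preimage[unfolded vimage_def Int_def mem_Collect_eq]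
          continuous_on_kernel p \<open>open \<Omega>\<close>) auto
    moreover have "(\<gamma> \<longlongrightarrow> p) (nhds 0)"
      using \<open>isCont \<gamma> 0\<close> \<gamma>0 by (simp add: continuous_at tendsto_nhds_iff)
    ultimately have "\<forall>\<^sub>F t in nhds 0. \<gamma> t \<in> {\<xi> \<in> \<Omega>. B p \<xi> \<in> - {0}}"
      using p kernel_diagonal(1)[OF p \<open>bounded \<Omega>\<close>] by (intro topological_tendstoD) auto
    then show "\<forall>\<^sub>F t in nhds 0. B p (\<gamma> t) \<noteq> 0"
      by eventually_elim auto
  qed
  then obtain \<epsilon> where \<epsilon>: "\<epsilon> > 0"
    and near: "\<And>t. \<bar>t\<bar> < \<epsilon> \<Longrightarrow> x p + t *\<^sub>R D v \<in> x ` \<Omega> \<and> B p (\<gamma> t) \<noteq> 0"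
    unfolding eventually_nhds_metric by (auto simp: dist_real_def)
  have \<gamma>_in: "\<gamma> t \<in> \<Omega>" and x\<gamma>: "x (\<gamma> t) = x p + t *\<^sub>R D v" if "\<bar>t\<bar> < \<epsilon>" for t
    using near[OF that] by (auto simp: \<gamma>_def inv_into_into f_inv_into_f)
  have nonzero: "B (\<gamma> 0) (\<gamma> t) \<noteq> 0" if "\<bar>t\<bar> < \<epsilon>" for t
    using near[OF that] by (simp add: \<gamma>0)
  obtain c \<alpha> where c: "c \<ge> 0" and \<alpha>: "\<And>t. \<bar>t\<bar> < \<epsilon> \<Longrightarrow> \<alpha> t > (0::real)"
    and B\<gamma>: "\<And>t s. \<bar>t\<bar> < \<epsilon> \<Longrightarrow> \<bar>s\<bar> < \<epsilon> \<Longrightarrow> (cmod (B (\<gamma> t) (\<gamma> s)))\<^sup>2 = \<alpha> t * \<alpha> s * exp (c * t * s)"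
    using kernel_along_coordinate_line[OF \<open>bounded \<Omega>\<close> ae \<epsilon> \<gamma>_in x\<gamma> nonzero] by blast
  obtain R where R: "R > 0" and norm_R: "\<And>z. z \<in> \<Omega> \<Longrightarrow> norm z \<le> R"
    using \<open>bounded \<Omega>\<close> unfolding bounded_pos by blast
  have "(1::complex) = 0"
  proof (rule exp_kernel_multiplier_derivative_zero[OF \<epsilon> c coord'])
    fix I :: "nat set" and a t :: "nat \<Rightarrow> real"
    assume "finite I" and t: "\<And>i. i \<in> I \<Longrightarrow> \<bar>t i\<bar> < \<epsilon>"
    \<comment> \<open>The \<open>k\<close>-th coordinate is a multiplier bounded by
      \<open>R\<close>. Dividing the weights by \<open>\<alpha>\<close> cancels the factors of the
      squared modulus of \<open>B\<close> along \<open>\<gamma>\<close> and leaves the exponential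
      kernel, with \<open>R\<^sup>2\<close> as the constant.\<close>
    have "0 \<le> (\<Sum>i\<in>I. \<Sum>j\<in>I. a i / \<alpha> (t i) * (a j / \<alpha> (t j)) *
       (R\<^sup>2 - Re (\<gamma> (t i) $ k * cnj (\<gamma> (t j) $ k))) * (cmod (B (\<gamma> (t i)) (\<gamma> (t j))))\<^sup>2)"
    proof (rule norm_square_kernel_multiplier_positive_semidefinite[OF \<open>finite I\<close> _ holomorphic_sv_nth _ R])
      show "\<gamma> (t i) \<in> \<Omega>" if "i \<in> I" for i
        using that by (intro \<gamma>_in t)
      show "cmod (\<xi> $ k) \<le> R" if "\<xi> \<in> \<Omega>" for \<xi>
        using norm_R[OF that] Finite_Cartesian_Product.norm_nth_le[of \<xi> k] by simp
    qed
    also have "\<dots> = (\<Sum>i\<in>I. \<Sum>j\<in>I. a i * a j *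
       (R\<^sup>2 - Re (\<gamma> (t i) $ k * cnj (\<gamma> (t j) $ k))) * exp (c * t i * t j))"
    proof (intro sum.cong refl)
      fix i j assume "i \<in> I" "j \<in> I"
      then show "a i / \<alpha> (t i) * (a j / \<alpha> (t j)) *
          (R\<^sup>2 - Re (\<gamma> (t i) $ k * cnj (\<gamma> (t j) $ k))) * (cmod (B (\<gamma> (t i)) (\<gamma> (t j))))\<^sup>2
        = a i * a j * (R\<^sup>2 - Re (\<gamma> (t i) $ k * cnj (\<gamma> (t j) $ k))) * exp (c * t i * t j)"
        using \<alpha>[OF t[of i]] \<alpha>[OF t[of j]] B\<gamma>[OF t[of i] t[of j]] by (simp add: field_simps)
    qed
    finally show "0 \<le> (\<Sum>i\<in>I. \<Sum>j\<in>I. a i * a j *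
       (R\<^sup>2 - Re (\<gamma> (t i) $ k * cnj (\<gamma> (t j) $ k))) * exp (c * t i * t j))" .
  qed
  then show False by simp
qed

end
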